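(* Let $a>0$ and $\beta<2$, and let $(Q_n)_{n\ge 0}$ be the monic orthogonal polynomials ($\deg Q_n=n$) on the shifted lattice $\mathbb N+1-\beta=\{1-\beta,2-\beta,3-\beta,\ldots\}$ satisfying $$\sum_{k=0}^\infty Q_n(k+1-\beta)\,Q_m(k+1-\beta)\,\frac{a^k}{k!\,(2-\beta)_k}=0,\qquad n\ne m.$$ Let $\hat a_n^2$ and $\hat b_n$ be the coefficients in their three-term recurrence relation $$xQ_n(x)=Q_{n+1}(x)+\hat b_nQ_n(x)+\hat a_n^2Q_{n-1}(x),\qquad n\ge 0,$$ with $Q_{-1}=0$, $Q_0=1$ and $\hat a_0^2=0$. Then $$\hat b_n+\hat b_{n-1}-n+\beta=\frac{an}{\hat a_n^2}\qquad(n\ge 1),$$ $$(\hat a_{n+1}^2-a)(\hat a_n^2-a)=a\,(\hat b_n-n)(\hat b_n-n+\beta-1)\qquad(n\ge 0),$$ with initial conditions $$\hat a_0^2=0,\qquad \hat b_0=\frac{\sqrt a\,I_{-\beta}(2\sqrt a)}{I_{1-\beta}(2\sqrt a)}.$$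
   Context: $\mathbb N=\{0,1,2,\ldots\}$. $(x)_k=x(x+1)\cdots(x+k-1)$, $(x)_0=1$, is the Pochhammer symbol. $I_\nu$ is the modified Bessel function $I_\nu(z)=\sum_{k=0}^\infty \frac{(z/2)^{2k+\nu}}{k!\,\Gamma(k+\nu+1)}$ (for $z>0$), where $1/\Gamma$ is taken to be $0$ at the poles of $\Gamma$. The weights $\frac{a^k}{k!(2-\beta)_k}$ are, up to a constant factor independent of $k$ (which does not affect the monic orthogonal polynomials), the values $w(k+1-\beta)$ of the weight function $w(x)=\frac{\Gamma(\beta)a^x}{\Gamma(\beta+x)\Gamma(x+1)}$. *)

theory Defs
  imports "HOL-Analysis.Analysis" "HOL-Computational_Algebra.Polynomial"
begin

text \<open>
  Modified Bessel function of real order, for \<open>z > 0\<close>.  The library's \<^const>\<open>rGamma\<close> is the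
  entire reciprocal Gamma function, so it is \<open>0\<close> at the poles of Gamma.
\<close>
definition besselI :: "real \<Rightarrow> real \<Rightarrow> real" where
  "besselI \<nu> z =
     (\<Sum>k. (z / 2) powr (2 * real k + \<nu>) * rGamma (real k + \<nu> + 1) / fact k)"

text \<open>Mass at the lattice point \<open>k + 1 - \<beta>\<close>.\<close>
definition lattice_weight :: "real \<Rightarrow> real \<Rightarrow> nat \<Rightarrow> real" where
  "lattice_weight a \<beta> k = a ^ k / (fact k * pochhammer (2 - \<beta>) k)"

definition monic_orthogonal_polys :: "real \<Rightarrow> real \<Rightarrow> (nat \<Rightarrow> real poly) \<Rightarrow> bool" where
  "monic_orthogonal_polys a \<beta> Q \<longleftrightarrow>
     (\<forall>n. degree (Q n) = n \<and> lead_coeff (Q n) = 1) \<and>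
     (\<forall>n m. n \<noteq> m \<longrightarrow>
        (\<lambda>k. poly (Q n) (real k + 1 - \<beta>) * poly (Q m) (real k + 1 - \<beta>)
              * lattice_weight a \<beta> k) sums 0)"

text \<open>
  The sequence \<open>A\<close> holds the coefficients written as squares in the literature; no sign
  condition on \<open>A\<close> is imposed.  The case distinction encodes the convention that the
  polynomial of index \<open>-1\<close> is \<open>0\<close>.
\<close>
definition three_term_recurrence ::
    "(nat \<Rightarrow> real poly) \<Rightarrow> (nat \<Rightarrow> real) \<Rightarrow> (nat \<Rightarrow> real) \<Rightarrow> bool" where
  "three_term_recurrence Q A b \<longleftrightarrow>
     A 0 = 0 \<and> Q 0 = 1 \<and>
     (\<forall>n. [:0, 1:] * Q n =
        Q (Suc n) + smult (b n) (Q n) + smult (A n) (if n = 0 then 0 else Q (n - 1)))"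

end

(* Write w_k for the weights, x_k = k + 1 - beta for the nodes and L p for the sum of p(x_k) w_k.
   The weights satisfy x_k (x_k + beta - 1) w_k = a w_(k-1), and the left-hand side vanishes at k = 0,
   hence L (x (x + beta - 1) p(x)) = a L (p(x + 1)) for every polynomial p.  This forces the
   expansion of Q_n(x + 1) in the Q_m to stop after three terms:
     Q_n(x + 1) = Q_n + n Q_(n-1) + (A_n A_(n-1) / a) Q_(n-2).
   Putting p = Q_n Q_(n-1) into the identity for L gives the first equation; p = Q_n^2, together
   with the compatibility of the expansion with the three-term recurrence, gives the second.
   The value of b_0 is L x / L 1, and both sums are Bessel series. *)
theory Submission
  imports Defs
begin

section \<open>Weights: recursions and summability\<close>

lemma lattice_weight_0 [simp]: "lattice_weight a \<beta> 0 = 1"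
  by (simp add: lattice_weight_def)

text \<open>The discrete Pearson equation: at the node x = k + 2 - beta of index k + 1 the left
  factor is x (x + beta - 1).\<close>

lemma lattice_weight_Suc:
  assumes "\<beta> < 2"
  shows "(real k + 1) * (real k + 2 - \<beta>) * lattice_weight a \<beta> (Suc k) = a * lattice_weight a \<beta> k"
proof -
  have "pochhammer (2 - \<beta>) k > 0" and "real k + 2 - \<beta> > 0" and "1 + real k > 0"
    using assms by (auto intro: pochhammer_pos)
  then show ?thesis
    by (simp add: lattice_weight_def pochhammer_Suc divide_simps) (simp add: algebra_simps)
qed

text \<open>From (c)_(k+1) = c (c + 1)_k with c = 2 - beta. It absorbs a factor k in a summand by
  lowering beta by 1.\<close>

lemma lattice_weight_Suc_shift:
  assumes "\<beta> < 2"
  shows "(real k + 1) * lattice_weight a \<beta> (Suc k) = a / (2 - \<beta>) * lattice_weight a (\<beta> - 1) k"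
proof -
  define c p where "c = 2 - \<beta>" and "p = pochhammer (c + 1) k"
  have pos: "c > 0" "p > 0" "1 + real k > 0"
    using assms by (auto simp: c_def p_def intro: pochhammer_pos)
  have Suc: "lattice_weight a \<beta> (Suc k) = a * a ^ k / ((1 + real k) * fact k * (c * p))"
    by (simp add: lattice_weight_def pochhammer_rec c_def p_def)
  have shift: "lattice_weight a (\<beta> - 1) k = a ^ k / (fact k * p)"
    by (simp add: lattice_weight_def c_def p_def)
  show ?thesis
    unfolding Suc shift c_def[symmetric] using pos by (simp add: divide_simps)
qed

lemma lattice_weight_pos: "a > 0 \<Longrightarrow> \<beta> < 2 \<Longrightarrow> lattice_weight a \<beta> k > 0"
  by (simp add: lattice_weight_def pochhammer_pos)

lemma summable_lattice_weight:
  assumes "\<beta> < 2"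
  shows "summable (lattice_weight a \<beta>)"
proof -
  \<comment> \<open>From \<open>N\<close> on, the ratio a / ((k + 1) (k + 2 - beta)) of consecutive
    weights is at most 1/2 in absolute value.\<close>
  obtain N :: nat where N: "2 * \<bar>a\<bar> / (2 - \<beta>) \<le> real N"
    using real_arch_simple by blast
  have "norm (lattice_weight a \<beta> (Suc k)) \<le> 1 / 2 * norm (lattice_weight a \<beta> k)" if "k \<ge> N" for k
  proof -
    have c: "2 - \<beta> > 0" using assms by simp
    have "2 * \<bar>a\<bar> \<le> real N * (2 - \<beta>)"
      using N c by (simp add: field_simps)
    also have "\<dots> \<le> (real k + 1) * (real k + 2 - \<beta>)"
      using that c by (intro mult_mono) auto
    finally have "2 * \<bar>a\<bar> * \<bar>lattice_weight a \<beta> (Suc k)\<bar>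
        \<le> (real k + 1) * (real k + 2 - \<beta>) * \<bar>lattice_weight a \<beta> (Suc k)\<bar>"
      by (intro mult_right_mono) auto
    also have "\<dots> = \<bar>(real k + 1) * (real k + 2 - \<beta>) * lattice_weight a \<beta> (Suc k)\<bar>"
      using c by (simp add: abs_mult)
    also have "\<dots> = \<bar>a\<bar> * \<bar>lattice_weight a \<beta> k\<bar>"
      by (simp only: lattice_weight_Suc[OF assms] abs_mult)
    \<comment> \<open>For a = 0 the common factor |a| does not cancel, but then every weight after
      the first is 0.\<close>
    finally show ?thesis
      by (cases "a = 0") (simp_all add: lattice_weight_def[of 0] mult.left_commute[of 2])
  qed
  then show ?thesis
    by (intro summable_ratio_test[of "1 / 2" N]) auto
qed

text \<open>
  Multiplication by the node \<open>k + 1 - \<beta>\<close> splits into a constant and a factor \<open>k\<close>, and the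
  latter turns the weight with parameter \<open>\<beta>\<close> into the one with parameter \<open>\<beta> - 1\<close> on the same
  nodes; hence the induction generalizes over \<open>\<beta>\<close>.
\<close>
lemma summable_poly_lattice_weight:
  assumes "\<beta> < 2"
  shows "summable (\<lambda>k. poly p (real k + 1 - \<beta>) * lattice_weight a \<beta> k)"
  using assms
proof (induction p arbitrary: \<beta>)
  case 0
  then show ?case by simp
next
  case (pCons c p)
  have "summable (\<lambda>k. poly p (real k + 1 - (\<beta> - 1)) * lattice_weight a (\<beta> - 1) k)"
    using pCons.prems by (intro pCons.IH) simp
  then have "summable (\<lambda>k. a / (2 - \<beta>) * (poly p (real k + 1 - (\<beta> - 1)) * lattice_weight a (\<beta> - 1) k))"
    by (rule summable_mult)
  also have "(\<lambda>k. a / (2 - \<beta>) * (poly p (real k + 1 - (\<beta> - 1)) * lattice_weight a (\<beta> - 1) k)) =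
    (\<lambda>k. real (Suc k) * poly p (real (Suc k) + 1 - \<beta>) * lattice_weight a \<beta> (Suc k))"
  proof
    fix k
    have "a / (2 - \<beta>) * (poly p (real k + 1 - (\<beta> - 1)) * lattice_weight a (\<beta> - 1) k)
      = poly p (real k + 1 - (\<beta> - 1)) * ((real k + 1) * lattice_weight a \<beta> (Suc k))"
      by (subst lattice_weight_Suc_shift[OF pCons.prems]) simp
    moreover have "real k + 1 - (\<beta> - 1) = real (Suc k) + 1 - \<beta>" by simp
    ultimately show "a / (2 - \<beta>) * (poly p (real k + 1 - (\<beta> - 1)) * lattice_weight a (\<beta> - 1) k)
      = real (Suc k) * poly p (real (Suc k) + 1 - \<beta>) * lattice_weight a \<beta> (Suc k)"
      by (simp only:) (simp add: algebra_simps)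
  qed
  finally have 1: "summable (\<lambda>k. real k * poly p (real k + 1 - \<beta>) * lattice_weight a \<beta> k)"
    by (subst (asm) summable_Suc_iff)
  have 2: "summable (\<lambda>k. (1 - \<beta>) * (poly p (real k + 1 - \<beta>) * lattice_weight a \<beta> k))"
    using pCons by (intro summable_mult) auto
  have 3: "summable (\<lambda>k. c * lattice_weight a \<beta> k)"
    using pCons.prems by (intro summable_mult summable_lattice_weight)
  have "poly (pCons c p) (real k + 1 - \<beta>) * lattice_weight a \<beta> k = c * lattice_weight a \<beta> k
    + (real k * poly p (real k + 1 - \<beta>) * lattice_weight a \<beta> k
       + (1 - \<beta>) * (poly p (real k + 1 - \<beta>) * lattice_weight a \<beta> k))" for k
    by (simp add: algebra_simps)
  then show ?case
    using summable_add[OF 3 summable_add[OF 1 2]] by simp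
qed

section \<open>The moment functional and its Pearson identity\<close>

definition lattice_functional :: "real \<Rightarrow> real \<Rightarrow> real poly \<Rightarrow> real" where
  "lattice_functional a \<beta> p = (\<Sum>k. poly p (real k + 1 - \<beta>) * lattice_weight a \<beta> k)"

lemma lattice_functional_add:
  "\<beta> < 2 \<Longrightarrow> lattice_functional a \<beta> (p + q) = lattice_functional a \<beta> p + lattice_functional a \<beta> q"
  using suminf_add[OF summable_poly_lattice_weight summable_poly_lattice_weight]
  by (simp add: lattice_functional_def distrib_right)

lemma lattice_functional_smult:
  "\<beta> < 2 \<Longrightarrow> lattice_functional a \<beta> (smult c p) = c * lattice_functional a \<beta> p"
  using suminf_mult[OF summable_poly_lattice_weight, of \<beta> c p a]
  by (simp add: lattice_functional_def mult.assoc)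

text \<open>A nonzero polynomial has finitely many roots, so it is nonzero at one of the infinitely
  many nodes, and no term of the sum is negative.\<close>

lemma lattice_functional_pos:
  assumes "a > 0" "\<beta> < 2" "p \<noteq> 0"
  shows "lattice_functional a \<beta> (p * p) > 0"
proof -
  have "infinite (range (\<lambda>k. real k + 1 - \<beta>))"
    by (rule range_inj_infinite) (auto simp: inj_def)
  then have "\<not> range (\<lambda>k. real k + 1 - \<beta>) \<subseteq> {x. poly p x = 0}"
    using poly_roots_finite[OF assms(3)] finite_subset by blast
  then obtain k where "poly p (real k + 1 - \<beta>) \<noteq> 0"
    by auto
  then show ?thesis
    unfolding lattice_functional_def
    using assms lattice_weight_pos[OF assms(1,2)]
    by (intro suminf_pos2[of _ k] summable_poly_lattice_weight)
       (auto simp: less_imp_le zero_less_mult_iff zero_le_mult_iff linorder_neq_iff)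
qed

text \<open>The factor x + beta - 1 equals k at the node of index k, so the term at k = 0 drops out
  and the weight recursion shifts the remaining sum by one index.\<close>

lemma lattice_functional_pearson:
  assumes "\<beta> < 2"
  shows "lattice_functional a \<beta> ([:0, \<beta> - 1, 1:] * p) = a * lattice_functional a \<beta> (p \<circ>\<^sub>p [:1, 1:])"
proof -
  let ?f = "\<lambda>k. poly ([:0, \<beta> - 1, 1:] * p) (real k + 1 - \<beta>) * lattice_weight a \<beta> k"
  have "?f (Suc k) = a * (poly (p \<circ>\<^sub>p [:1, 1:]) (real k + 1 - \<beta>) * lattice_weight a \<beta> k)" for k
  proof -
    have "poly (p \<circ>\<^sub>p [:1, 1:]) (real k + 1 - \<beta>) = poly p (real (Suc k) + 1 - \<beta>)"
      by (simp add: poly_pcompose algebra_simps)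
    then have "a * (poly (p \<circ>\<^sub>p [:1, 1:]) (real k + 1 - \<beta>) * lattice_weight a \<beta> k) =
      poly p (real (Suc k) + 1 - \<beta>) * (a * lattice_weight a \<beta> k)"
      by simp
    also have "\<dots> = ?f (Suc k)"
      unfolding lattice_weight_Suc[OF assms, symmetric] by (simp add: algebra_simps)
    finally show ?thesis ..
  qed
  then have "(\<Sum>k. ?f (Suc k)) = a * lattice_functional a \<beta> (p \<circ>\<^sub>p [:1, 1:])"
    by (simp only: lattice_functional_def suminf_mult[OF summable_poly_lattice_weight[OF assms]])
  moreover have "(\<Sum>k. ?f (Suc k)) = suminf ?f - ?f 0"
    by (rule suminf_split_head[OF summable_poly_lattice_weight[OF assms]])
  ultimately show ?thesis
    by (simp add: lattice_functional_def algebra_simps)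
qed

section \<open>Top coefficients of shifted polynomials\<close>

lemma coeff_pcompose_shift_degree:
  fixes p :: "'a :: comm_ring_1 poly"
  assumes "degree p \<le> n"
  shows "coeff (p \<circ>\<^sub>p [:c, 1:]) n = coeff p n"
  using assms
proof (induction p arbitrary: n)
  case 0
  then show ?case by simp
next
  case (pCons b p)
  have deg: "degree (p \<circ>\<^sub>p [:c, 1:]) \<le> degree p" using degree_pcompose_le[of p "[:c, 1:]"] by simp
  show ?case
  proof (cases "p = 0")
    case False
    then obtain m where "n = Suc m" "degree p \<le> m" using pCons.prems by (cases n) auto
    then show ?thesis using pCons.IH[of m] deg
      by (simp add: pcompose_pCons coeff_eq_0)
  qed (simp add: pcompose_pCons)
qed

text \<open>By Taylor, p(x + c) = p + c p' + terms of degree at most deg p - 2. This is the source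
  of the coefficient n in the expansion of Q_n(x + 1).\<close>

lemma coeff_pcompose_shift_subdegree:
  fixes p :: "'a :: comm_ring_1 poly"
  assumes "degree p \<le> Suc n"
  shows "coeff (p \<circ>\<^sub>p [:c, 1:]) n = coeff p n + of_nat (Suc n) * c * coeff p (Suc n)"
  using assms
proof (induction p arbitrary: n)
  case 0
  then show ?case by simp
next
  case (pCons b p)
  have "degree p \<le> n" using pCons.prems by (cases "p = 0") auto
  then show ?case using coeff_pcompose_shift_degree[of p n c] pCons.IH[of "n - 1"]
    by (cases n) (auto simp: pcompose_pCons algebra_simps)
qed

section \<open>Orthogonality and squared norms\<close>

locale lattice_orthogonal_polys =
  fixes a \<beta> :: real and Q :: "nat \<Rightarrow> real poly" and A b :: "nat \<Rightarrow> real"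
  assumes a_pos: "a > 0" and beta_less: "\<beta> < 2"
    and monic_orthogonal: "monic_orthogonal_polys a \<beta> Q"
    and three_term: "three_term_recurrence Q A b"
begin

abbreviation L :: "real poly \<Rightarrow> real" where "L \<equiv> lattice_functional a \<beta>"

definition h :: "nat \<Rightarrow> real" where "h n = L (Q n * Q n)"

lemmas L_add = lattice_functional_add[OF beta_less, of a]
lemmas L_smult = lattice_functional_smult[OF beta_less, of a]

lemma L_0: "L 0 = 0"
  using L_smult[of 0 0] by simp

lemma L_diff: "L (p - q) = L p - L q"
  using L_add[of "p - q" q] by simp

lemmas L_linear = L_0 L_add L_diff L_smult

lemma degree_Q [simp]: "degree (Q n) = n" and coeff_Q [simp]: "coeff (Q n) n = 1"
  using monic_orthogonal unfolding monic_orthogonal_polys_def by metis+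

lemma Q_nonzero [simp]: "Q n \<noteq> 0"
  using coeff_Q[of n] by fastforce

lemma Q_0: "Q 0 = 1" and A_0 [simp]: "A 0 = 0"
  using three_term by (auto simp: three_term_recurrence_def)

text \<open>For \<open>n = 0\<close> the truncated index \<open>n - 1\<close> is harmless because \<open>A 0 = 0\<close>.\<close>
lemma recurrence: "[:0, 1:] * Q n = Q (Suc n) + smult (b n) (Q n) + smult (A n) (Q (n - 1))"
proof -
  have "smult (A n) (if n = 0 then 0 else Q (n - 1)) = smult (A n) (Q (n - 1))"
    by simp
  then show ?thesis
    using three_term unfolding three_term_recurrence_def by metis
qed

lemma L_Q_Q: "L (Q n * Q m) = (if n = m then h n else 0)"
proof (cases "n = m")
  case False
  then show ?thesis
    using monic_orthogonal unfolding monic_orthogonal_polys_def lattice_functional_def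
    by (auto dest!: sums_unique[symmetric])
qed (simp add: h_def)

lemma h_pos: "h n > 0"
  unfolding h_def by (rule lattice_functional_pos[OF a_pos beta_less]) simp

text \<open>Subtracting a multiple of Q_n lowers the degree. The degree bound is put as vanishing
  coefficients so that n = 0 means p = 0 and starts the induction.\<close>

lemma L_Q_eq_0:
  assumes "\<And>i. i \<ge> n \<Longrightarrow> coeff p i = 0" "n \<le> m"
  shows "L (Q m * p) = 0"
  using assms
proof (induction n arbitrary: p)
  case 0
  then have "p = 0" by (simp add: poly_eq_iff)
  then show ?case by (simp add: L_0)
next
  case (Suc n)
  have "L (Q m * (p - smult (coeff p n) (Q n))) = 0"
  proof (rule Suc.IH)
    show "coeff (p - smult (coeff p n) (Q n)) i = 0" if "i \<ge> n" for i
      using that Suc.prems by (cases "i = n") (auto simp: coeff_eq_0)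
  qed (use Suc.prems in auto)
  then show ?case using Suc.prems(2)
    by (simp add: right_diff_distrib L_linear L_Q_Q)
qed

lemma L_Q_low: "degree p < m \<Longrightarrow> L (Q m * p) = 0"
  by (rule L_Q_eq_0[of m]) (auto simp: coeff_eq_0)

text \<open>Removing the top term by a multiple of \<open>Q n\<close> leaves a polynomial of degree
  below n, which is orthogonal to \<open>Q n\<close>.\<close>

lemma L_Q_top:
  assumes "degree p \<le> n"
  shows "L (Q n * p) = coeff p n * h n"
proof -
  have "L (Q n * (p - smult (coeff p n) (Q n))) = 0"
    by (rule L_Q_eq_0[of n]) (use assms in \<open>auto simp: coeff_eq_0 le_less\<close>)
  then show ?thesis
    by (simp add: right_diff_distrib L_linear L_Q_Q)
qed

text \<open>Pairing a nonzero p with the Q of its own degree gives its leading coefficient times a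
  positive norm.\<close>

lemma eq_0_if_orthogonal:
  assumes "\<And>m. m \<le> n \<Longrightarrow> L (p * Q m) = 0" "degree p \<le> n"
  shows "p = 0"
proof (rule ccontr)
  assume "p \<noteq> 0"
  then have "coeff p (degree p) * h (degree p) \<noteq> 0"
    using h_pos[of "degree p"] by simp
  then show False
    using L_Q_top[of p "degree p"] assms by (simp add: mult.commute)
qed

section \<open>Expansion of the shifted polynomials Q_n(x + 1)\<close>

abbreviation P :: "nat \<Rightarrow> real poly" where "P n \<equiv> Q n \<circ>\<^sub>p [:1, 1:]"

text \<open>The Pearson identity for Q_n(x) p(x - 1). It moves the shift from Q_n to the test
  polynomial, whose degree rises by only two.\<close>

lemma L_P_mult: "a * L (P n * p) = L (Q n * ([:0, \<beta> - 1, 1:] * (p \<circ>\<^sub>p [:-1, 1:])))"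
proof -
  have "p \<circ>\<^sub>p [:-1, 1:] \<circ>\<^sub>p [:1, 1:] = p"
    by (simp add: pcompose_assoc[symmetric] pcompose_pCons)
  then have "P n * p = (Q n * (p \<circ>\<^sub>p [:-1, 1:])) \<circ>\<^sub>p [:1, 1:]"
    by (simp add: pcompose_mult)
  then show ?thesis
    using lattice_functional_pearson[OF beta_less, of a "Q n * (p \<circ>\<^sub>p [:-1, 1:])"]
    by (simp only: mult.left_commute)
qed

lemma degree_Q_shift [simp]: "degree (Q n \<circ>\<^sub>p [:c, 1:]) = n"
  by (simp add: degree_pcompose)

lemma coeff_Q_shift [simp]: "coeff (Q n \<circ>\<^sub>p [:c, 1:]) n = 1"
  by (simp add: coeff_pcompose_shift_degree)

lemma degree_shifted_pearson: "degree ([:0, \<beta> - 1, 1:] * (Q n \<circ>\<^sub>p [:-1, 1:])) = n + 2"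
  and coeff_shifted_pearson: "coeff ([:0, \<beta> - 1, 1:] * (Q n \<circ>\<^sub>p [:-1, 1:])) (n + 2) = 1"
proof -
  let ?q = "Q n \<circ>\<^sub>p [:-1, 1:]"
  have "?q \<noteq> 0"
    using coeff_Q_shift[of n "-1"] by fastforce
  then show "degree ([:0, \<beta> - 1, 1:] * ?q) = n + 2"
    by (subst degree_mult_eq) auto
  have "degree [:0, \<beta> - 1, 1:] = 2" by simp
  with coeff_mult_degree_sum[of "[:0, \<beta> - 1, 1:]" ?q]
  show "coeff ([:0, \<beta> - 1, 1:] * ?q) (n + 2) = 1"
    by (simp add: numeral_2_eq_2 add.commute)
qed

text \<open>After the shift is moved, Q_n is paired with a polynomial of degree m + 2 < n.\<close>

lemma L_P_Q_low: "m + 2 < n \<Longrightarrow> L (P n * Q m) = 0"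
  using L_P_mult[of n "Q m"] L_Q_low[of "[:0, \<beta> - 1, 1:] * (Q m \<circ>\<^sub>p [:-1, 1:])" n] a_pos
  by (simp only: degree_shifted_pearson) simp

lemma L_P_Q_Suc_Suc: "L (P (Suc (Suc n)) * Q n) = h (Suc (Suc n)) / a"
  using L_P_mult[of "n + 2" "Q n"] L_Q_top[of "[:0, \<beta> - 1, 1:] * (Q n \<circ>\<^sub>p [:-1, 1:])" "n + 2"] a_pos
  by (simp only: degree_shifted_pearson coeff_shifted_pearson) (simp add: field_simps)

lemma L_P_Q_same: "L (P n * Q n) = h n"
  using L_Q_top[of "P n" n] by (simp add: mult.commute)

text \<open>Q_(n+1) is orthogonal to Q_n, so it may be subtracted; the difference has degree at most
  n, with coefficient n + 1 there.\<close>

lemma L_P_Q_Suc: "L (P (Suc n) * Q n) = real (Suc n) * h n"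
proof -
  have "degree (P (Suc n) - Q (Suc n)) \<le> n"
  proof (rule degree_le, intro allI impI)
    fix i assume "i > n"
    then show "coeff (P (Suc n) - Q (Suc n)) i = 0"
      by (cases "i = Suc n") (auto simp: coeff_pcompose_shift_degree coeff_eq_0)
  qed
  from L_Q_top[OF this] show ?thesis
    by (simp add: coeff_pcompose_shift_subdegree right_diff_distrib L_linear L_Q_Q mult.commute)
qed

lemma L_X_Q_Q_Suc: "L ([:0, 1:] * Q n * Q (Suc n)) = h (Suc n)"
  unfolding recurrence by (simp add: distrib_right L_linear L_Q_Q)

text \<open>L (x Q_n Q_(n+1)) is evaluated twice, the recurrence being applied to x Q_n or to x
  Q_(n+1).\<close>

lemma h_Suc: "h (Suc n) = A (Suc n) * h n"
proof -
  have "L ([:0, 1:] * Q (Suc n) * Q n) = A (Suc n) * h n"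
    unfolding recurrence by (simp add: distrib_right L_linear L_Q_Q)
  then show ?thesis
    using L_X_Q_Q_Suc[of n] by (simp only: mult_ac)
qed

lemma A_Suc_pos: "A (Suc n) > 0"
  using h_Suc[of n] h_pos[of n] h_pos[of "Suc n"] by (simp add: zero_less_mult_iff)

text \<open>For n >= 2 this is h_n / (a h_(n-2)), the coefficient of Q_(n-2) in \<open>P n\<close>;
  for n <= 1 it is 0 because \<open>A 0 = 0\<close>.\<close>

definition E :: "nat \<Rightarrow> real" where "E n = A n * A (n - 1) / a"

text \<open>The truncated indices \<open>n - 1\<close> and \<open>n - 2\<close> only occur with vanishing coefficients.\<close>
lemma structure_relation:
  "P n = Q n + smult (real n) (Q (n - 1)) + smult (E n) (Q (n - 2))" (is "_ = ?R")
proof -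
  \<comment> \<open>Both sides have degree at most n, so comparing their pairings with Q_0, ..., Q_n
    suffices.\<close>
  have "L ((P n - ?R) * Q m) = 0" if "m \<le> n" for m
  proof -
    consider "m = n" | "n = Suc m" | "n = Suc (Suc m)" | "m + 2 < n"
      using \<open>m \<le> n\<close> by linarith
    then show ?thesis
    proof cases
      case 1
      then show ?thesis
        by (cases n; cases "n - 1")
           (simp_all add: left_diff_distrib distrib_right L_linear L_Q_Q L_P_Q_same E_def del: of_nat_Suc)
    next
      case 2
      then show ?thesis
        by (cases m) (simp_all add: left_diff_distrib distrib_right L_linear L_Q_Q L_P_Q_Suc E_def del: of_nat_Suc)
    next
      case 3
      then show ?thesis using a_pos
        by (simp add: left_diff_distrib distrib_right L_linear L_Q_Q L_P_Q_Suc_Suc E_def h_Suc del: of_nat_Suc)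
    next
      case 4
      then have "n - 1 \<noteq> m" "n - 2 \<noteq> m" by auto
      with 4 show ?thesis
        by (simp add: left_diff_distrib distrib_right L_linear L_Q_Q L_P_Q_low)
    qed
  qed
  moreover have "degree (P n - ?R) \<le> n"
    by (intro degree_diff_le degree_add_le degree_smult_le[THEN order_trans]) auto
  ultimately have "P n - ?R = 0"
    by (rule eq_0_if_orthogonal)
  then show ?thesis by simp
qed

section \<open>The two nonlinear equations\<close>

lemma pearson_P_P: "L ([:0, 1:] * Q n * ([:0, 1:] * Q m)) + (\<beta> - 1) * L ([:0, 1:] * Q n * Q m) = a * L (P n * P m)"
proof -
  \<comment> \<open>The square x^2 is split so that each Q carries its own factor x, ready for the
    recurrence.\<close>
  have "[:0, \<beta> - 1, 1:] = [:0, 1:] * [:0, 1:] + smult (\<beta> - 1) [:0, 1:]"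
    by simp
  then have "[:0, \<beta> - 1, 1:] * (Q n * Q m) = [:0, 1:] * Q n * ([:0, 1:] * Q m) + smult (\<beta> - 1) ([:0, 1:] * Q n * Q m)"
    by (simp only: distrib_left distrib_right mult_smult_left mult_smult_right mult_ac)
  then show ?thesis
    using lattice_functional_pearson[OF beta_less, of a "Q n * Q m"]
    by (simp only: pcompose_mult L_linear)
qed

lemma sum_relation: "b (Suc n) + b n - real (Suc n) + \<beta> = a * real (Suc n) / A (Suc n)"
proof -
  have "L ([:0, 1:] * Q (Suc n) * ([:0, 1:] * Q n)) = (b (Suc n) + b n) * h (Suc n)"
    unfolding recurrence
    by (cases n) (simp_all add: distrib_left distrib_right L_linear L_Q_Q h_Suc)
  moreover have "L ([:0, 1:] * Q (Suc n) * Q n) = h (Suc n)"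
    unfolding recurrence by (simp add: distrib_right L_linear L_Q_Q h_Suc)
  moreover have "L (P (Suc n) * P n) = real (Suc n) * h n + E (Suc n) * (real n * h (n - 1))"
  proof (cases n)
    case (Suc m)
    show ?thesis
      unfolding structure_relation Suc
      by (cases m) (simp_all add: distrib_left distrib_right L_linear L_Q_Q E_def add_divide_distrib mult_ac)
  qed (simp add: structure_relation distrib_left distrib_right L_linear L_Q_Q E_def)
  ultimately have "(b (Suc n) + b n + \<beta> - 1) * h (Suc n)
      = a * (real (Suc n) * h n + E (Suc n) * (real n * h (n - 1)))"
    using pearson_P_P[of "Suc n" n] by (simp add: algebra_simps)
  \<comment> \<open>Since A_(n+1) A_n h_(n-1) = h_(n+1) for n > 0, this term moves to the left and
    turns beta - 1 into beta - (n + 1).\<close>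
  also have "a * (E (Suc n) * (real n * h (n - 1))) = real n * h (Suc n)"
    using a_pos by (cases n) (simp_all add: h_Suc E_def)
  then have "a * (real (Suc n) * h n + E (Suc n) * (real n * h (n - 1))) = a * real (Suc n) * h n + real n * h (Suc n)"
    by (simp add: algebra_simps)
  finally have "(b (Suc n) + b n - real (Suc n) + \<beta>) * A (Suc n) * h n = a * real (Suc n) * h n"
    by (simp add: h_Suc algebra_simps)
  then have "(b (Suc n) + b n - real (Suc n) + \<beta>) * A (Suc n) = a * real (Suc n)"
    using h_pos[of n] by (simp del: of_nat_Suc)
  then show ?thesis
    using A_Suc_pos[of n] by (simp add: eq_divide_eq del: of_nat_Suc)
qed

text \<open>L ((x + 1) P_(n+1) Q_n) is computed twice: by the shifted recurrence for (x + 1)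
  P_(n+1), and by the recurrence for x Q_n.\<close>

lemma E_diff: "E (Suc (Suc n)) - E (Suc n) = real (Suc n) * (b n - b (Suc n) + 1)"
proof -
  have shift: "[:1, 1:] * P (Suc n) = P (Suc (Suc n)) + smult (b (Suc n)) (P (Suc n)) + smult (A (Suc n)) (P n)"
    using arg_cong[OF recurrence[of "Suc n"], of "\<lambda>p. p \<circ>\<^sub>p [:1, 1:]"]
    by (simp add: pcompose_mult pcompose_add pcompose_smult pcompose_pCons del: mult_pCons_left)
  have "L ([:1, 1:] * P (Suc n) * Q n) = E (Suc (Suc n)) * h n + b (Suc n) * real (Suc n) * h n + A (Suc n) * h n"
    unfolding shift using a_pos
    by (simp add: distrib_right L_linear L_P_Q_same L_P_Q_Suc L_P_Q_Suc_Suc E_def h_Suc) (simp add: algebra_simps)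
  moreover have "[:1, 1:] * P (Suc n) * Q n = P (Suc n) * (Q n + [:0, 1:] * Q n)"
    by (simp add: algebra_simps)
  moreover have "A n * L (P (Suc n) * Q (n - 1)) = E (Suc n) * h n"
    using a_pos by (cases n) (simp_all add: L_P_Q_Suc_Suc E_def h_Suc)
  then have "L (P (Suc n) * (Q n + [:0, 1:] * Q n))
      = real (Suc n) * h n + A (Suc n) * h n + b n * real (Suc n) * h n + E (Suc n) * h n"
    unfolding recurrence by (simp add: distrib_left L_linear L_P_Q_same L_P_Q_Suc h_Suc)
  ultimately have "(E (Suc (Suc n)) - E (Suc n)) * h n = real (Suc n) * (b n - b (Suc n) + 1) * h n"
    by (simp add: algebra_simps)
  then show ?thesis
    using h_pos[of n] by simp
qed

text \<open>The identity \<open>pearson_P_P\<close> with both indices n, divided by h_n; the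
  quotient h_(n-1) / h_n is 1 / A_n for n > 0.\<close>

lemma square_relation:
  "A (Suc n) + A n + (b n)\<^sup>2 + (\<beta> - 1) * b n
    = a + (if n = 0 then 0 else a * (real n)\<^sup>2 / A n) + E n"
proof -
  have "L ([:0, 1:] * Q n * ([:0, 1:] * Q n)) = (A (Suc n) + A n + (b n)\<^sup>2) * h n"
    unfolding recurrence
    by (simp only: distrib_left distrib_right mult_smult_left mult_smult_right L_linear L_Q_Q)
       (cases n; simp add: h_Suc power2_eq_square algebra_simps)
  moreover have "L ([:0, 1:] * Q n * Q n) = b n * h n"
    unfolding recurrence by (cases n) (simp_all add: distrib_right L_linear L_Q_Q)
  moreover have "L (P n * P n) = h n + (real n)\<^sup>2 * h (n - 1) + (E n)\<^sup>2 * h (n - 2)"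
    unfolding structure_relation
    by (simp only: distrib_left distrib_right mult_smult_left mult_smult_right L_linear L_Q_Q)
       (cases n; cases "n - 1"; simp add: E_def power2_eq_square algebra_simps)
  \<comment> \<open>One factor a E_n = A_n A_(n-1) raises h_(n-2) to h_n.\<close>
  moreover have "a * ((E n)\<^sup>2 * h (n - 2)) = E n * h n"
  proof (cases n)
    case (Suc k)
    then show ?thesis
      using a_pos by (cases k) (simp_all add: E_def h_Suc power2_eq_square)
  qed (simp add: E_def)
  moreover have "a * ((real n)\<^sup>2 * h (n - 1)) = (if n = 0 then 0 else a * (real n)\<^sup>2 / A n) * h n"
  proof (cases n)
    case (Suc k)
    have "h k = h n / A n"
      using A_Suc_pos[of k] by (simp add: Suc h_Suc)
    then show ?thesis by (simp add: Suc)
  qed simp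
  ultimately have "(A (Suc n) + A n + (b n)\<^sup>2 + (\<beta> - 1) * b n) * h n
      = (a + (if n = 0 then 0 else a * (real n)\<^sup>2 / A n) + E n) * h n"
    using pearson_P_P[of n n] by (simp only: distrib_left distrib_right mult.assoc)
  then show ?thesis
    using h_pos[of n] by (simp only: mult_cancel_right) auto
qed

text \<open>In \<open>square_relation\<close>, \<open>sum_relation\<close> removes the quotient by
  A_n and \<open>E_diff\<close> trades E_n for E_(n+1); then a E_(n+1) = A_(n+1) A_n makes the
  A-terms factor.\<close>

lemma product_relation:
  "(A (Suc n) - a) * (A n - a) = a * (b n - real n) * (b n - real n + \<beta> - 1)"
proof (cases n)
  case 0
  \<comment> \<open>Here A_0 = E_0 = 0, so the square relation gives A_1 explicitly.\<close>
  have A_1: "A (Suc 0) = a - (b 0)\<^sup>2 - (\<beta> - 1) * b 0"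
    using square_relation[of 0] by (simp add: E_def)
  show ?thesis
    unfolding 0 A_1 by (simp add: power2_eq_square algebra_simps)
next
  case (Suc k)
  have "a * (real n)\<^sup>2 / A n = real n * (b n + b k - real n + \<beta>)"
    using sum_relation[of k] unfolding Suc by (simp add: power2_eq_square)
  moreover have "E (Suc n) - E n = real n * (b k - b n + 1)"
    using E_diff[of k] unfolding Suc .
  ultimately have "A (Suc n) + A n + (b n)\<^sup>2 + (\<beta> - 1) * b n
      = a + real n * (b n + b k - real n + \<beta>) + E (Suc n) - real n * (b k - b n + 1)"
    using square_relation[of n] Suc by simp
  then have "E (Suc n) = A (Suc n) + A n - a + (b n - real n) * (b n - real n + \<beta> - 1)"
    by (simp add: power2_eq_square algebra_simps)
  moreover have "a * E (Suc n) = A (Suc n) * A n"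
    using a_pos by (simp add: E_def)
  ultimately have "A (Suc n) * A n = a * (A (Suc n) + A n - a + (b n - real n) * (b n - real n + \<beta> - 1))"
    by simp
  then show ?thesis
    by (simp add: algebra_simps)
qed

lemma b_0: "b 0 * L 1 = L [:0, 1:]"
proof -
  have "L ([:0, 1:] * Q 0 * Q 0) = b 0 * h 0"
    unfolding recurrence by (simp add: distrib_right L_linear L_Q_Q)
  then show ?thesis
    by (simp add: Q_0 h_def)
qed

end

section \<open>Bessel series and the initial value\<close>

lemma rGamma_plus_nat:
  assumes "z > (0 :: real)"
  shows "rGamma (real k + z) = rGamma z / pochhammer z k"
proof -
  have "pochhammer z k > 0" using assms by (rule pochhammer_pos)
  then show ?thesis
    using pochhammer_rGamma[of z k] by (simp add: field_simps)
qed

lemma powr_half_two_sqrt: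
  assumes "a > 0"
  shows "(2 * sqrt a / 2) powr (2 * real k + \<nu>) = sqrt a powr \<nu> * a ^ k"
proof -
  have "sqrt a powr (2 * real k) = a ^ k"
    using assms by (simp add: powr_half_sqrt[symmetric] powr_powr powr_realpow)
  then show ?thesis by (simp add: powr_add)
qed

lemma besselI_one_minus:
  assumes "a > 0" "\<beta> < 2"
  shows "besselI (1 - \<beta>) (2 * sqrt a)
    = sqrt a powr (1 - \<beta>) * rGamma (2 - \<beta>) * lattice_functional a \<beta> 1"
proof -
  have "(2 * sqrt a / 2) powr (2 * real k + (1 - \<beta>)) * rGamma (real k + (1 - \<beta>) + 1) / fact k
      = sqrt a powr (1 - \<beta>) * rGamma (2 - \<beta>) * (poly 1 (real k + 1 - \<beta>) * lattice_weight a \<beta> k)" for k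
    using assms rGamma_plus_nat[of "2 - \<beta>" k]
    by (simp only: powr_half_two_sqrt lattice_weight_def) (simp add: algebra_simps)
  then show ?thesis
    unfolding besselI_def lattice_functional_def
    by (simp only: suminf_mult[OF summable_poly_lattice_weight[OF assms(2)]])
qed

lemma besselI_minus:
  assumes "a > 0" "\<beta> < 2"
  shows "besselI (- \<beta>) (2 * sqrt a)
    = sqrt a powr (- \<beta>) * rGamma (2 - \<beta>) * lattice_functional a \<beta> [:0, 1:]"
proof -
  \<comment> \<open>The functional equation of \<open>rGamma\<close> produces the node as a factor;
    it also holds at the pole met for beta = 1, k = 0.\<close>
  have "rGamma (real k + - \<beta> + 1) = (real k + 1 - \<beta>) * rGamma (2 - \<beta>) / pochhammer (2 - \<beta>) k" for k
    using assms rGamma_plus_nat[of "2 - \<beta>" k] rGamma_plus1[of "real k + 1 - \<beta>"]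
    by (simp add: algebra_simps)
  then have "(2 * sqrt a / 2) powr (2 * real k + - \<beta>) * rGamma (real k + - \<beta> + 1) / fact k
      = sqrt a powr (- \<beta>) * rGamma (2 - \<beta>) * (poly [:0, 1:] (real k + 1 - \<beta>) * lattice_weight a \<beta> k)" for k
    using assms
    by (simp only: powr_half_two_sqrt lattice_weight_def) (simp add: mult_ac)
  then show ?thesis
    unfolding besselI_def lattice_functional_def
    by (simp only: suminf_mult[OF summable_poly_lattice_weight[OF assms(2)]])
qed

lemma besselI_ratio:
  assumes "a > 0" "\<beta> < 2"
  shows "sqrt a * besselI (- \<beta>) (2 * sqrt a) / besselI (1 - \<beta>) (2 * sqrt a)
    = lattice_functional a \<beta> [:0, 1:] / lattice_functional a \<beta> 1"
proof -
  \<comment> \<open>The prefactors of the two series differ by exactly the factor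
    \<open>sqrt a\<close> in the numerator.\<close>
  have "sqrt a powr (1 - \<beta>) = sqrt a * sqrt a powr (- \<beta>)"
    using assms by (simp add: powr_mult_base)
  moreover have "rGamma (2 - \<beta>) > 0"
    using assms by (simp add: rGamma_inverse_Gamma Gamma_real_pos)
  ultimately show ?thesis
    using assms by (simp add: besselI_minus besselI_one_minus)
qed

theorem theorem2p2:
  fixes a \<beta> :: real
    and Q :: "nat \<Rightarrow> real poly"
    and ahat2 bhat :: "nat \<Rightarrow> real"
  assumes "a > 0" and "\<beta> < 2"
    and "monic_orthogonal_polys a \<beta> Q"
    and "three_term_recurrence Q ahat2 bhat"
  shows "(\<forall>n\<ge>1. bhat n + bhat (n - 1) - real n + \<beta> = a * real n / ahat2 n)
    \<and> (\<forall>n. (ahat2 (n + 1) - a) * (ahat2 n - a)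
             = a * (bhat n - real n) * (bhat n - real n + \<beta> - 1))
    \<and> ahat2 0 = 0
    \<and> bhat 0 = sqrt a * besselI (- \<beta>) (2 * sqrt a) / besselI (1 - \<beta>) (2 * sqrt a)"
proof -
  interpret lattice_orthogonal_polys a \<beta> Q ahat2 bhat
    using assms by unfold_locales
  have "bhat n + bhat (n - 1) - real n + \<beta> = a * real n / ahat2 n" if "n \<ge> 1" for n
    using that sum_relation[of "n - 1"] by (cases n) auto
  moreover have "L 1 > 0"
    using h_pos[of 0] by (simp add: h_def Q_0)
  then have "bhat 0 = L [:0, 1:] / L 1"
    using b_0 by (simp add: field_simps)
  ultimately show ?thesis
    using product_relation assms(1,2) by (auto simp: besselI_ratio)
qed

end
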